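(* Let $\gamma$ be a constant with $2\log_2 3-3\le\gamma\le 1$ and let $\beta=(1-\gamma)/2$. For every $n\ge k\ge 0$ and every graph $G$ on $n$ vertices, the number of minimal vertex covers of $G$ of size at most $k$ is at most $2^{\beta n+\gamma k}$.
   Context: Graphs are finite, simple and undirected. A vertex cover of $G=(V,E)$ is a set $C\subseteq V$ containing at least one endpoint of every edge; it is minimal if no proper subset of it is a vertex cover. *)

theory Defs
  imports Complex_Main
begin

(* Edges are two-element sets of vertices, so loops and parallel edges cannot occur. *)

definition simple_graph :: "'a set \<Rightarrow> 'a set set \<Rightarrow> bool" where
  "simple_graph V E \<longleftrightarrow> finite V \<and> (\<forall>e\<in>E. e \<subseteq> V \<and> card e = 2)"

definition vertex_cover :: "'a set \<Rightarrow> 'a set set \<Rightarrow> 'a set \<Rightarrow> bool" where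
  "vertex_cover V E C \<longleftrightarrow> C \<subseteq> V \<and> (\<forall>e\<in>E. \<exists>v\<in>e. v \<in> C)"

definition minimal_vertex_cover :: "'a set \<Rightarrow> 'a set set \<Rightarrow> 'a set \<Rightarrow> bool" where
  "minimal_vertex_cover V E C \<longleftrightarrow> vertex_cover V E C \<and> (\<forall>D. D \<subset> C \<longrightarrow> \<not> vertex_cover V E D)"

end

theory Submission
  imports Defs
begin

text \<open>
  Put \<open>x = 2 powr \<beta>\<close> and \<open>z = 2 powr (- \<gamma>) = x\<^sup>2 / 2\<close>. Weighting a cover \<open>C\<close> by \<open>z ^ card C\<close> removes the
  size bound \<open>k\<close>: it suffices that the total weight of the minimal vertex covers is at most \<open>x ^ n\<close>.
  Let \<open>v\<close> have minimum degree \<open>d\<close>. A minimal cover misses some \<open>u\<close> in the closed neighbourhood of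
  \<open>v\<close>; it then contains all neighbours of \<open>u\<close>, and the rest of it is a minimal cover of the graph
  with the closed neighbourhood of \<open>u\<close> deleted. Induction bounds the total weight by
  \<open>x ^ (n - 1) * (d + 1) * r ^ d\<close> with \<open>r = x / 2\<close>, and \<open>(d + 1) * r ^ d \<le> 2 * r = x\<close> for every \<open>d\<close>
  precisely when \<open>1 / 2 \<le> r \<le> 2 / 3\<close>, which is what the two bounds on \<open>\<gamma>\<close> say.
\<close>

section \<open>Neighbourhoods and induced subgraphs\<close>

definition neighbours :: "'a set set \<Rightarrow> 'a \<Rightarrow> 'a set" where
  "neighbours E u = {w. {u, w} \<in> E}"

definition induced_edges :: "'a set set \<Rightarrow> 'a set \<Rightarrow> 'a set set" where
  "induced_edges E W = {e \<in> E. e \<subseteq> W}"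

definition minimal_covers :: "'a set \<Rightarrow> 'a set set \<Rightarrow> 'a set set" where
  "minimal_covers V E = {C. minimal_vertex_cover V E C}"

lemma simple_graph_induced:
  assumes "simple_graph V E" and "W \<subseteq> V"
  shows "simple_graph W (induced_edges E W)"
  using assms unfolding simple_graph_def induced_edges_def by (auto intro: finite_subset)

lemma neighbours_subset:
  assumes "simple_graph V E"
  shows "neighbours E u \<subseteq> V"
  using assms unfolding simple_graph_def neighbours_def by auto

lemma not_neighbour_self:
  assumes "simple_graph V E"
  shows "u \<notin> neighbours E u"
  using assms unfolding simple_graph_def neighbours_def by fastforce

lemma edge_at:
  assumes "simple_graph V E" and "e \<in> E" and "u \<in> e"
  obtains w where "e = {u, w}" and "w \<in> neighbours E u"
proof -
  have "card e = 2"
    using assms(1,2) unfolding simple_graph_def by blast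
  then obtain a b where "e = {a, b}"
    by (auto simp: card_2_iff)
  then obtain w where "e = {u, w}"
    using assms(3) by blast
  then show thesis
    using that assms(2) unfolding neighbours_def by blast
qed

lemma finite_minimal_covers:
  assumes "simple_graph V E"
  shows "finite (minimal_covers V E)"
proof (rule finite_subset)
  show "minimal_covers V E \<subseteq> Pow V"
    unfolding minimal_covers_def minimal_vertex_cover_def vertex_cover_def by blast
  show "finite (Pow V)"
    using assms unfolding simple_graph_def by simp
qed

section \<open>Minimal covers that miss a given vertex\<close>

lemma neighbours_subset_cover:
  assumes "vertex_cover V E C" and "u \<notin> C"
  shows "neighbours E u \<subseteq> C"
  using assms unfolding vertex_cover_def neighbours_def by fastforce

text \<open>Otherwise \<open>v\<close> could be dropped from \<open>C\<close>: every edge at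
  \<open>v\<close> is still covered by its other end.\<close>

lemma minimal_cover_misses_closed_neighbourhood:
  assumes G: "simple_graph V E" and C: "minimal_vertex_cover V E C"
  shows "\<exists>u \<in> insert v (neighbours E v). u \<notin> C"
proof (rule ccontr)
  assume "\<not> ?thesis"
  then have v: "v \<in> C" and N: "neighbours E v \<subseteq> C"
    by auto
  have "\<exists>w\<in>e. w \<in> C - {v}" if e: "e \<in> E" for e
  proof (cases "v \<in> e")
    case True
    then obtain w where "e = {v, w}" "w \<in> neighbours E v"
      using edge_at[OF G e] by blast
    then show ?thesis
      using N not_neighbour_self[OF G, of v] by blast
  next
    case False
    then show ?thesis
      using C e unfolding minimal_vertex_cover_def vertex_cover_def by blast
  qed
  moreover have "C \<subseteq> V"
    using C unfolding minimal_vertex_cover_def vertex_cover_def by blast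
  ultimately have "vertex_cover V E (C - {v})"
    unfolding vertex_cover_def by (intro conjI ballI) auto
  then show False
    using C v unfolding minimal_vertex_cover_def by blast
qed

text \<open>Minimality is inherited because a smaller cover \<open>D\<close> of the remaining graph
  would extend to the cover \<open>D \<union> neighbours E u\<close> of the whole graph, strictly
  inside \<open>C\<close>: every edge leaving \<open>W\<close> meets
  \<open>neighbours E u\<close>.\<close>

lemma minimal_cover_delete_closed_neighbourhood:
  assumes G: "simple_graph V E" and C: "minimal_vertex_cover V E C" and u: "u \<notin> C"
    and W: "W = V - insert u (neighbours E u)"
  shows "minimal_vertex_cover W (induced_edges E W) (C - neighbours E u)"
proof -
  have cover: "vertex_cover V E C"
    using C unfolding minimal_vertex_cover_def by blast
  have N: "neighbours E u \<subseteq> C"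
    using neighbours_subset_cover[OF cover u] .
  have "vertex_cover W (induced_edges E W) (C - neighbours E u)"
    using cover u unfolding vertex_cover_def induced_edges_def W by blast
  moreover have "\<not> vertex_cover W (induced_edges E W) D" if D: "D \<subset> C - neighbours E u" for D
  proof
    assume D_cover: "vertex_cover W (induced_edges E W) D"
    have "\<exists>w\<in>e. w \<in> D \<union> neighbours E u" if e: "e \<in> E" for e
    proof (cases "e \<subseteq> W")
      case True
      then show ?thesis
        using D_cover e unfolding vertex_cover_def induced_edges_def by blast
    next
      case False
      have "e \<subseteq> V"
        using G e unfolding simple_graph_def by blast
      then consider "u \<in> e" | "e \<inter> neighbours E u \<noteq> {}"
        using False W by blast
      then show ?thesis
      proof cases
        case 1
        then show ?thesis
          using edge_at[OF G e] by blast
      next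
        case 2
        then show ?thesis by blast
      qed
    qed
    moreover have "D \<union> neighbours E u \<subseteq> V"
      using D cover N unfolding vertex_cover_def by blast
    ultimately have "vertex_cover V E (D \<union> neighbours E u)"
      unfolding vertex_cover_def by blast
    moreover have "D \<union> neighbours E u \<subset> C"
      using D N by blast
    ultimately show False
      using C unfolding minimal_vertex_cover_def by blast
  qed
  ultimately show ?thesis
    unfolding minimal_vertex_cover_def by blast
qed

text \<open>All covers in question contain \<open>neighbours E u\<close>, so removing it is
  injective and divides out a common factor of the weight. Only an inequality results, since the
  image may be a proper subset of the minimal covers of the smaller graph.\<close>

lemma weight_covers_missing_vertex:
  fixes z :: real
  assumes G: "simple_graph V E" and z: "0 \<le> z"
    and W: "W = V - insert u (neighbours E u)"
  shows "(\<Sum>C \<in> {C \<in> minimal_covers V E. u \<notin> C}. z ^ card C)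
    \<le> z ^ card (neighbours E u) * (\<Sum>C \<in> minimal_covers W (induced_edges E W). z ^ card C)"
proof -
  let ?N = "neighbours E u"
  let ?A = "{C \<in> minimal_covers V E. u \<notin> C}"
  have N: "?N \<subseteq> C" and C_fin: "finite C" if "C \<in> ?A" for C
  proof -
    have C: "vertex_cover V E C" "u \<notin> C"
      using that unfolding minimal_covers_def minimal_vertex_cover_def by auto
    then show "?N \<subseteq> C"
      by (rule neighbours_subset_cover)
    show "finite C"
      using C G unfolding vertex_cover_def simple_graph_def by (blast intro: finite_subset)
  qed
  have "z ^ card C = z ^ card ?N * z ^ card (C - ?N)" if "C \<in> ?A" for C
  proof -
    have "finite ?N"
      using N[OF that] C_fin[OF that] by (rule finite_subset)
    then have "card C = card ?N + card (C - ?N)"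
      using card_Diff_subset[OF _ N[OF that]] card_mono[OF C_fin[OF that] N[OF that]] by simp
    then show ?thesis
      by (simp add: power_add)
  qed
  then have "(\<Sum>C \<in> ?A. z ^ card C) = z ^ card ?N * (\<Sum>C \<in> ?A. z ^ card (C - ?N))"
    by (simp add: sum_distrib_left)
  also have "(\<Sum>C \<in> ?A. z ^ card (C - ?N)) = (\<Sum>C \<in> (\<lambda>C. C - ?N) ` ?A. z ^ card C)"
  proof (rule sum.reindex_cong[symmetric, where l = "\<lambda>C. C - ?N"])
    show "inj_on (\<lambda>C. C - ?N) ?A"
      using N by (intro inj_onI) blast
  qed auto
  also have "z ^ card ?N * \<dots>
      \<le> z ^ card ?N * (\<Sum>C \<in> minimal_covers W (induced_edges E W). z ^ card C)"
  proof (intro mult_left_mono sum_mono2)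
    have "simple_graph W (induced_edges E W)"
      using G W by (intro simple_graph_induced) auto
    then show "finite (minimal_covers W (induced_edges E W))"
      by (rule finite_minimal_covers)
    show "(\<lambda>C. C - ?N) ` ?A \<subseteq> minimal_covers W (induced_edges E W)"
      using minimal_cover_delete_closed_neighbourhood[OF G _ _ W]
      unfolding minimal_covers_def by blast
  qed (use z in auto)
  finally show ?thesis .
qed

section \<open>Two inequalities for the sum over branches\<close>

lemma sum_UN_le:
  fixes f :: "'b \<Rightarrow> 'c::ordered_comm_monoid_add"
  assumes "finite I" and "\<And>i. i \<in> I \<Longrightarrow> finite (A i)"
    and "\<And>x. 0 \<le> f x"
  shows "sum f (\<Union>i\<in>I. A i) \<le> (\<Sum>i\<in>I. sum f (A i))"
  using assms(1,2)
proof (induction I rule: finite_induct)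
  case (insert i I)
  let ?U = "\<Union>i\<in>I. A i"
  have fin: "finite (A i)" "finite ?U"
    using insert by auto
  have "sum f (A i \<union> ?U) = sum f (A i - ?U) + sum f ?U"
    using sum.union_disjoint[of "A i - ?U" ?U f] fin by (simp add: Un_commute Int_commute)
  also have "\<dots> \<le> sum f (A i) + (\<Sum>i\<in>I. sum f (A i))"
    using fin insert assms(3) by (intro add_mono sum_mono2) auto
  finally show ?case
    using insert by simp
qed simp

lemma Suc_times_power_le_double:
  fixes r :: real
  assumes "1 / 2 \<le> r" and "r \<le> 2 / 3"
  shows "real (Suc d) * r ^ d \<le> 2 * r"
proof -
  \<comment> \<open>This is the case \<open>d = m + 2\<close> divided by \<open>r\<close>. Its base
    \<open>3 * r \<le> 2\<close> is where the bound \<open>2 / 3\<close> is tight;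
    \<open>d = 0\<close> needs \<open>1 / 2 \<le> r\<close>, and \<open>d = 1\<close> is an
    equality.\<close>
  have *: "real (m + 3) * r ^ (m + 1) \<le> 2" for m
  proof (induction m)
    case 0
    then show ?case using assms by simp
  next
    case (Suc m)
    have "real (Suc m + 3) * r \<le> real (Suc m + 3) * (2 / 3)"
      using assms by (intro mult_left_mono) auto
    also have "\<dots> \<le> real (m + 3)"
      by simp
    finally have "real (Suc m + 3) * r * r ^ (m + 1) \<le> real (m + 3) * r ^ (m + 1)"
      using assms by (intro mult_right_mono) auto
    with Suc show ?case
      by (simp add: mult.assoc)
  qed
  consider "d = 0" | "d = 1" | m where "d = m + 2"
    by (metis One_nat_def Suc_1 add.commute add_Suc add_cancel_right_left not0_implies_Suc)
  then show ?thesis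
  proof cases
    case 3
    then have "real (Suc d) * r ^ d = real (m + 3) * r ^ (m + 1) * r"
      by (simp add: algebra_simps)
    also have "\<dots> \<le> 2 * r"
      using *[of m] assms by (intro mult_right_mono) auto
    finally show ?thesis .
  qed (use assms in auto)
qed

text \<open>Strong induction on the number of vertices, because a branch deletes a whole closed
  neighbourhood. The range of \<open>x\<close> is the range of \<open>r = x / 2\<close> in
  \<open>Suc_times_power_le_double\<close>.\<close>

lemma weight_minimal_covers_le:
  fixes x :: real
  assumes x: "1 \<le> x" "x \<le> 4 / 3" and G: "simple_graph V E"
  shows "(\<Sum>C \<in> minimal_covers V E. (x\<^sup>2 / 2) ^ card C) \<le> x ^ card V"
  using G
proof (induction "card V" arbitrary: V E rule: less_induct)
  case less
  note G = less.prems
  define z where "z = x\<^sup>2 / 2"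
  define r where "r = x / 2"
  have z0: "0 \<le> z" and z: "z = r * x" and r0: "0 \<le> r" and r1: "r \<le> 1"
    using x by (auto simp: z_def r_def power2_eq_square)
  have V_fin: "finite V"
    using G unfolding simple_graph_def by blast
  show ?case
  proof (cases "V = {}")
    case True
    have "minimal_covers V E \<subseteq> {{}}"
      using True unfolding minimal_covers_def minimal_vertex_cover_def vertex_cover_def by blast
    then have "(\<Sum>C \<in> minimal_covers V E. z ^ card C) \<le> (\<Sum>C \<in> {{} :: 'a set}. z ^ card C)"
      using z0 by (intro sum_mono2) auto
    then show ?thesis
      using True by (simp add: z_def)
  next
    case False
    let ?N = "neighbours E"
    \<comment> \<open>Since \<open>r \<le> 1\<close>, minimality of the degree of \<open>v\<close>
      gives all \<open>d + 1\<close> branches the same bound, whatever the degree of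
      \<open>u\<close>.\<close>
    obtain v where v: "v \<in> V" and v_min: "\<And>u. u \<in> V \<Longrightarrow> card (?N v) \<le> card (?N u)"
      using ex_has_least_nat[of "\<lambda>u. u \<in> V" _ "\<lambda>u. card (?N u)"] False by blast
    define d where "d = card (?N v)"
    define B where "B = insert v (?N v)"
    have N_fin: "finite (?N u)" for u
      using neighbours_subset[OF G] V_fin by (rule finite_subset)
    have B: "finite B" "B \<subseteq> V" "card B = Suc d"
      using N_fin neighbours_subset[OF G] v not_neighbour_self[OF G] by (auto simp: B_def d_def)
    have branch: "(\<Sum>C \<in> {C \<in> minimal_covers V E. u \<notin> C}. z ^ card C) \<le> x ^ (card V - 1) * r ^ d"
      if u: "u \<in> B" for u
    proof -
      define W where "W = V - insert u (?N u)"
      have uV: "u \<in> V"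
        using u B by blast
      have sub: "insert u (?N u) \<subseteq> V"
        using uV neighbours_subset[OF G] by blast
      have "card (insert u (?N u)) = Suc (card (?N u))"
        using N_fin not_neighbour_self[OF G] by simp
      then have card_V: "card V = Suc (card W + card (?N u))"
        using card_Diff_subset[OF _ sub] card_mono[OF V_fin sub] N_fin by (simp add: W_def)
      have "(\<Sum>C \<in> {C \<in> minimal_covers V E. u \<notin> C}. z ^ card C)
          \<le> z ^ card (?N u) * (\<Sum>C \<in> minimal_covers W (induced_edges E W). z ^ card C)"
        using weight_covers_missing_vertex[OF G z0 W_def] .
      also have "\<dots> \<le> z ^ card (?N u) * x ^ card W"
        unfolding z_def
        by (intro mult_left_mono less.hyps simple_graph_induced[OF G]) (auto simp: card_V W_def)
      \<comment> \<open>Splitting \<open>z = r * x\<close> lets the powers of \<open>x\<close>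
        account for every vertex except \<open>u\<close>.\<close>
      also have "\<dots> = x ^ (card V - 1) * r ^ card (?N u)"
        by (simp add: z card_V power_add power_mult_distrib)
      also have "\<dots> \<le> x ^ (card V - 1) * r ^ d"
        using v_min[OF uV] r0 r1 x by (intro mult_left_mono power_decreasing) (auto simp: d_def)
      finally show ?thesis .
    qed
    have "minimal_covers V E \<subseteq> (\<Union>u\<in>B. {C \<in> minimal_covers V E. u \<notin> C})"
      using minimal_cover_misses_closed_neighbourhood[OF G]
      unfolding minimal_covers_def B_def by blast
    then have "minimal_covers V E = (\<Union>u\<in>B. {C \<in> minimal_covers V E. u \<notin> C})"
      by blast
    then have "(\<Sum>C \<in> minimal_covers V E. z ^ card C)
        = (\<Sum>C \<in> (\<Union>u\<in>B. {C \<in> minimal_covers V E. u \<notin> C}). z ^ card C)"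
      by simp
    \<comment> \<open>The branches may overlap: a cover is counted once for each vertex of
      \<open>B\<close> that it misses.\<close>
    also have "\<dots> \<le> (\<Sum>u\<in>B. \<Sum>C \<in> {C \<in> minimal_covers V E. u \<notin> C}. z ^ card C)"
      using B z0 finite_minimal_covers[OF G] by (intro sum_UN_le) auto
    also have "\<dots> \<le> (\<Sum>u\<in>B. x ^ (card V - 1) * r ^ d)"
      by (rule sum_mono) (rule branch)
    also have "\<dots> = x ^ (card V - 1) * (real (Suc d) * r ^ d)"
      using B by simp
    also have "\<dots> \<le> x ^ (card V - 1) * (2 * r)"
      using x by (intro mult_left_mono Suc_times_power_le_double) (auto simp: r_def)
    also have "\<dots> = x ^ card V"
      using False V_fin by (simp add: r_def power_minus_mult card_gt_0_iff del: One_nat_def)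
    finally show ?thesis
      by (simp add: z_def)
  qed
qed

theorem theorem7:
  fixes \<gamma> \<beta> :: real and n k :: nat and V :: "'a set" and E :: "'a set set"
  assumes "2 * log 2 3 - 3 \<le> \<gamma>" and "\<gamma> \<le> 1"
    and "\<beta> = (1 - \<gamma>) / 2"
    and "k \<le> n"
    and "simple_graph V E" and "card V = n"
  shows "real (card {C. minimal_vertex_cover V E C \<and> card C \<le> k}) \<le> 2 powr (\<beta> * real n + \<gamma> * real k)"
proof -
  define x where "x = 2 powr \<beta>"
  define z where "z = x\<^sup>2 / 2"
  let ?M = "{C. minimal_vertex_cover V E C \<and> card C \<le> k}"
  \<comment> \<open>The lower bound on \<open>\<gamma>\<close> gives
    \<open>\<beta> \<le> (1 - (2 * log 2 3 - 3)) / 2 = 2 - log 2 3\<close>.\<close>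
  have "2 powr \<beta> \<le> 2 powr (2 - log 2 3)"
    using assms(1,3) by simp
  also have "\<dots> = 4 / 3"
    by (simp add: powr_diff)
  finally have "x \<le> 4 / 3"
    by (simp add: x_def)
  moreover have "1 \<le> x"
    using assms(2,3) by (simp add: x_def ge_one_powr_ge_zero)
  ultimately have x: "1 \<le> x" "x \<le> 4 / 3"
    by simp_all
  \<comment> \<open>As \<open>16 / 9 < 2\<close>, this yields \<open>z \<le> 1\<close>, so a cover
    of size at most \<open>k\<close> has weight at least \<open>z ^ k\<close>.\<close>
  have "x * x \<le> 4 / 3 * (4 / 3)"
    using x by (intro mult_mono) auto
  then have z: "0 < z" "z \<le> 1"
    using x by (auto simp: z_def power2_eq_square)
  \<comment> \<open>The exponent is \<open>- \<gamma>\<close> by the choice of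
    \<open>\<beta>\<close>; dividing by \<open>z ^ k\<close> will produce the factor
    \<open>2 powr (\<gamma> * real k)\<close>.\<close>
  have "z = 2 powr (\<beta> + \<beta> - 1)"
    unfolding z_def x_def power2_eq_square by (simp only: powr_add powr_diff) simp
  then have z_eq: "z = 2 powr (- \<gamma>)"
    using assms(3) by simp
  have M: "?M \<subseteq> minimal_covers V E"
    unfolding minimal_covers_def by blast
  have "real (card ?M) * z ^ k = (\<Sum>C\<in>?M. z ^ k)"
    by simp
  also have "\<dots> \<le> (\<Sum>C\<in>?M. z ^ card C)"
    using z by (intro sum_mono power_decreasing) auto
  also have "\<dots> \<le> (\<Sum>C\<in>minimal_covers V E. z ^ card C)"
    using M z finite_minimal_covers[OF assms(5)] by (intro sum_mono2) auto
  also have "\<dots> \<le> x ^ n"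
    using weight_minimal_covers_le[OF x assms(5)] assms(6) by (simp add: z_def)
  finally have "real (card ?M) \<le> x ^ n / z ^ k"
    using z by (simp add: pos_le_divide_eq)
  also have "x ^ n = 2 powr (\<beta> * real n)"
    by (simp add: x_def powr_power mult.commute)
  also have "z ^ k = 2 powr (- (\<gamma> * real k))"
    by (simp add: z_eq powr_power mult.commute)
  also have "2 powr (\<beta> * real n) / 2 powr (- (\<gamma> * real k)) = 2 powr (\<beta> * real n + \<gamma> * real k)"
    by (simp flip: powr_diff)
  finally show ?thesis .
qed

end
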